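(* Let $q$ be a prime power and define $f:\mathbb{F}_{q^3}^*\to\mathbb{F}_{q^3}$ by $f(x)=(1-x^2)\,\mathrm{Tr}_{q^3/q}\!\left(\frac1x\right)+x$. Then $f$ is a permutation of $\mathbb{F}_{q^3}^*$ (i.e., a bijection $\mathbb{F}_{q^3}^*\to\mathbb{F}_{q^3}^*$) if and only if $q=3$.
   Context: $\mathrm{Tr}_{q^3/q}(y)=y+y^q+y^{q^2}$ is the trace from $\mathbb{F}_{q^3}$ to $\mathbb{F}_q$. *)

theory Defs
  imports "HOL-Number_Theory.Number_Theory" "HOL-Library.Cardinality"
begin

(* The field with q^3 elements is a type 'a of class {field, finite} with CARD('a) = q ^ 3;
   F_q is its subfield {c. c ^ q = c}.  The trace to F_q is written by its explicit formula,
   with values regarded as elements of 'a. *)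

definition cubic_trace :: "nat \<Rightarrow> 'a::field \<Rightarrow> 'a" where
  "cubic_trace q y = y + y ^ q + y ^ (q ^ 2)"

(* Only the values at x \<noteq> 0 are meaningful (1 / 0 = 0 in HOL). *)

definition trace_map :: "nat \<Rightarrow> 'a::field \<Rightarrow> 'a" where
  "trace_map q x = (1 - x ^ 2) * cubic_trace q (1 / x) + x"

end

theory Submission
  imports Defs "HOL-Computational_Algebra.Polynomial"
begin

text \<open>
  Write $t = \mathrm{Tr}(1/x)$, an element of the subfield with $q$ elements.  In characteristic at
  least 5 the prime field already spoils the claim: $f(1) = f(-3/2) = 1$, and $f(2) = 0$ when $5 = 0$.

  In characteristic 2 the map $f$ fixes every $x$ with $t = 0$, so a bijection must send elements with
  $t \neq 0$ to elements with $\mathrm{Tr}(1/f(x)) \neq 0$.  For $x = 1/(tw)$ with $\mathrm{Tr}(w) = 1$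
  the trace of $1/f(x)$ vanishes as soon as $t^4 N(w)^2 = 1 + e_2(w)$, which is solvable because
  squaring is bijective; it remains to find $w$ with $e_2(w) \neq 1$.

  In characteristic 3 with $q \geq 9$ a bijection would leave $\sum_x x^{2+2q} = 0$ invariant, while
  expanding $f$ as a Laurent polynomial in $1/x$ gives $\sum_x f(x)^{2+2q} = -8 = 1$.

  For $q = 3$ the elements with $t = 1$ are the roots of three cubics.  On them $f(x) = 1 + x - x^2$
  permutes the three cubics up to sign, and two elements of the same cubic with
  equal images would have to be $x$ and $1 - x$, which never share a cubic.
\<close>

section \<open>Power sums over a finite field\<close>

lemma finite_field_power_card:
  fixes x :: "'a::{field,finite}"
  shows "x ^ CARD('a) = x"
proof (cases "x = 0")
  case False
  let ?U = "UNIV - {0::'a}"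
  have "(\<Prod>y\<in>?U. y) = (\<Prod>y\<in>?U. x * y)"
    by (rule prod.reindex_bij_witness[of _ "\<lambda>y. x * y" "\<lambda>y. y / x"]) (use False in auto)
  also have "\<dots> = x ^ card ?U * (\<Prod>y\<in>?U. y)"
    by (simp add: prod.distrib)
  finally have "x ^ card ?U = 1"
    by simp
  moreover have "CARD('a) = Suc (card ?U)"
    by (rule card.remove) auto
  ultimately show ?thesis
    by (simp only: power_Suc mult_1_right)
qed (simp add: card_gt_0_iff)

text \<open>Only the residue of \<open>e\<close> modulo \<open>?N\<close> matters. If it is 0, every
  summand is 1 and their number is -1 in the field. Otherwise some unit \<open>g\<close> has
  \<open>g ^ r \<noteq> 1\<close>, and substituting \<open>g * x\<close> for \<open>x\<close>
  multiplies the sum by \<open>g ^ r\<close>.\<close>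

lemma sum_powi_units:
  "(\<Sum>x\<in>UNIV - {0}. (x :: 'a::{field,finite}) powi e) = (if int (CARD('a) - 1) dvd e then -1 else 0)"
proof -
  let ?U = "UNIV - {0::'a}" and ?N = "CARD('a) - 1"
  have "CARD('a) > 1"
    using card_mono[of UNIV "{0, 1::'a}"] by simp
  hence N: "?N > 0" "Suc ?N = CARD('a)" by auto
  have one: "x ^ ?N = 1" if "x \<noteq> 0" for x :: 'a
    proof -
    have "x * x ^ ?N = x"
      using finite_field_power_card[of x] N(2) by (metis power_Suc)
    thus ?thesis using that by simp
  qed
  have red: "x powi e = x ^ nat (e mod int ?N)" if "x \<noteq> 0" for x :: 'a
  proof -
    have "x powi e = x powi (int ?N * (e div int ?N) + e mod int ?N)"
      by simp
    also have "\<dots> = (x powi int ?N) powi (e div int ?N) * x powi (e mod int ?N)"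
      by (subst power_int_add) (use that in \<open>auto simp: power_int_mult\<close>)
    also have "\<dots> = x powi (int (nat (e mod int ?N)))"
      using N(1) one[OF that] by (simp only: power_int_of_nat power_int_1_left nat_0_le pos_mod_sign) simp
    finally show ?thesis by (simp only: power_int_of_nat)
  qed
  show ?thesis
  proof (cases "int ?N dvd e")
    case True
    have "CHAR('a) dvd CARD('a)" by (rule CHAR_dvd_CARD)
    hence "of_nat (Suc ?N) = (0::'a)"
      by (simp only: N(2) of_nat_eq_0_iff_char_dvd)
    hence "of_nat ?N = (-1::'a)" by (simp add: eq_neg_iff_add_eq_0 add.commute)
    moreover have "(\<Sum>x\<in>?U. x powi e) = (\<Sum>x\<in>?U. 1)"
      by (rule sum.cong) (use True red in auto)
    ultimately show ?thesis using True by (simp add: card_Diff_singleton)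
  next
    case False
    define r where "r = nat (e mod int ?N)"
    have r: "0 < r" "r < ?N"
      using False N(1) unfolding r_def
      by (auto simp: dvd_eq_mod_eq_0 nat_less_iff intro: le_neq_trans)
    \<comment> \<open>Otherwise all \<open>?N\<close> units would be roots of a nonzero polynomial
      of degree at most \<open>r < ?N\<close>.\<close>
    have "\<exists>g::'a. g \<noteq> 0 \<and> g ^ r \<noteq> 1"
    proof (rule ccontr)
      assume "\<not> (\<exists>g::'a. g \<noteq> 0 \<and> g ^ r \<noteq> 1)"
      hence all: "g ^ r = 1" if "g \<noteq> 0" for g :: 'a using that by blast
      let ?p = "monom 1 r - 1 :: 'a poly"
      have "coeff ?p r \<noteq> 0" using r by (simp add: coeff_1)
      hence nz: "?p \<noteq> 0" by (metis coeff_0)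
      have "?N = card ?U" by (simp add: card_Diff_singleton)
      also have "\<dots> \<le> card {x. poly ?p x = 0}"
        by (rule card_mono) (auto simp: poly_monom all)
      also have "\<dots> \<le> degree ?p" using card_poly_roots_bound[OF nz] by simp
      also have "\<dots> \<le> r" by (rule degree_diff_le) (auto simp: degree_monom_le)
      finally show False using r by simp
    qed
    then obtain g :: 'a where g: "g \<noteq> 0" "g ^ r \<noteq> 1" by blast
    have "(\<Sum>x\<in>?U. x ^ r) = (\<Sum>x\<in>?U. (g * x) ^ r)"
      by (rule sum.reindex_bij_witness[of _ "\<lambda>y. g * y" "\<lambda>y. y / g"]) (use g in auto)
    also have "\<dots> = g ^ r * (\<Sum>x\<in>?U. x ^ r)"
      by (simp add: power_mult_distrib sum_distrib_left)
    finally have "(\<Sum>x\<in>?U. x ^ r) = 0" using g by simp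
    moreover have "(\<Sum>x\<in>?U. x powi e) = (\<Sum>x\<in>?U. x ^ r)"
      by (rule sum.cong) (auto simp: red r_def)
    ultimately show ?thesis using False by simp
  qed
qed

section \<open>Frobenius and trace in the cubic extension\<close>

locale cubic_extension =
  fixes q :: nat and field_type :: "'a::{field,finite} itself"
  assumes primepow_q: "primepow q" and card_field: "CARD('a) = q ^ 3"
begin

abbreviation Tr :: "'a \<Rightarrow> 'a" where "Tr \<equiv> cubic_trace q"
abbreviation f :: "'a \<Rightarrow> 'a" where "f \<equiv> trace_map q"

text \<open>The characteristic divides the cardinality, a power of the prime below \<open>q\<close>,
  hence equals that prime. This makes the \<open>q\<close>-th power map additive.\<close>

lemma q_power_CHAR: "\<exists>k>0. q = CHAR('a) ^ k" and prime_CHAR: "prime CHAR('a)"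
proof -
  show pr: "prime CHAR('a)"
    using prime_CHAR_semidom[where ?'a = 'a] finite_imp_CHAR_pos[where ?'a = 'a] by simp
  obtain p k where pk: "prime p" "k > 0" "q = p ^ k"
    using primepow_q by (auto simp: primepow_def)
  have "CHAR('a) dvd p ^ (k * 3)"
    using CHAR_dvd_CARD[where ?'a = 'a] pk by (simp add: card_field power_mult)
  hence "CHAR('a) = p"
    using pr pk(1) by (metis prime_dvd_power primes_dvd_imp_eq)
  thus "\<exists>k>0. q = CHAR('a) ^ k" using pk by auto
qed

lemma q_gt_1: "q > 1"
  using primepow_gt_Suc_0[OF primepow_q] by simp

lemma of_nat_q: "of_nat q = (0::'a)"
  using q_power_CHAR by (auto simp: of_nat_eq_0_iff_char_dvd)

lemma frob_add: "(x + y) ^ q = x ^ q + (y::'a) ^ q"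
  using q_power_CHAR prime_CHAR freshmans_dream' by blast

lemma frob_minus: "(- x) ^ q = - ((x::'a) ^ q)"
  using frob_add[of "-x" x] q_gt_1 by (simp add: eq_neg_iff_add_eq_0 power_0_left)

lemma frob_diff: "(x - y) ^ q = x ^ q - (y::'a) ^ q"
  using frob_add[of x "-y"] by (simp add: frob_minus)

lemma frob_numeral: "(numeral n) ^ q = (numeral n :: 'a)"
proof -
  have "(of_nat m) ^ q = (of_nat m :: 'a)" for m
    by (induction m) (use q_gt_1 in \<open>auto simp: frob_add power_0_left\<close>)
  from this[of "numeral n"] show ?thesis by simp
qed

lemma frob_cubed: "(((x::'a) ^ q) ^ q) ^ q = x"
  using finite_field_power_card[of x]
  by (simp add: card_field power3_eq_cube flip: power_mult)

lemma Tr_eq: "Tr y = y + y ^ q + (y ^ q) ^ q"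
  by (simp add: cubic_trace_def power2_eq_square power_mult)

lemma frob_Tr: "Tr y ^ q = Tr y"
  by (simp add: Tr_eq frob_add frob_cubed)

lemma Tr_scale: "c ^ q = c \<Longrightarrow> Tr (c * y) = c * Tr y"
  by (simp add: Tr_eq power_mult_distrib algebra_simps)

lemma f_eq: "f x = (1 - x ^ 2) * Tr (1 / x) + x"
  by (simp add: trace_map_def)

section \<open>Characteristic at least 5\<close>

lemma not_bij_CHAR_ge_5:
  assumes "(2::'a) \<noteq> 0" "(3::'a) \<noteq> 0" "bij_betw f (UNIV - {0}) (UNIV - {0})"
  shows False
\<comment> \<open>The points 1 and -3/2 with common value 1 coincide exactly when 5 = 0. In that
  case 2 is mapped to 0 instead.\<close>
proof (cases "(5::'a) = 0")
  case True
  have "Tr (1 / 2) = 3 / 2"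
    using assms(1) by (simp add: Tr_eq power_divide frob_numeral)
  hence "f 2 = - 5 / 2"
    using assms(1) by (simp only: f_eq) (simp add: field_simps)
  with True have "f 2 = 0" by simp
  moreover have "f 2 \<in> UNIV - {0}"
    using assms by (intro bij_betw_apply[OF assms(3)]) auto
  ultimately show False by simp
next
  case False
  have triple: "y + y + y = 3 * y" for y :: 'a
    by simp
  have "- (2 / 3) + - (2 / 3) + - (2 / 3) = (- 2 :: 'a)"
    unfolding triple using assms(2) by simp
  hence "Tr (- (2 / 3)) = - 2"
    by (simp only: Tr_eq power_divide frob_numeral frob_minus)
  moreover have "1 / (- 3 / 2) = - (2 / 3 :: 'a)"
    using assms(1,2) by simp
  ultimately have "f (- 3 / 2) = (1 - (- 3 / 2) ^ 2) * (- 2) + (- 3 / 2)"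
    by (simp only: f_eq)
  also have "\<dots> = 1"
  proof -
    have "(1 - w ^ 2) * (- 2) + w = 1 + (w - 1) * (2 * w + 3)" for w :: 'a
      by (simp add: algebra_simps power2_eq_square)
    moreover have "2 * (- 3 / 2) + 3 = (0::'a)" using assms(1) by simp
    ultimately show ?thesis by (simp only: mult_zero_right add_0_right)
  qed
  finally have "f (- 3 / 2) = 1" .
  moreover have "- 3 / 2 \<noteq> (0::'a)" using assms(1,2) by simp
  moreover have "f 1 = 1" by (simp add: f_eq)
  ultimately have eq: "- 3 / 2 = (1::'a)"
    using bij_betw_imp_inj_on[OF assms(3)] zero_neq_one
    by (metis Diff_iff UNIV_I inj_onD singletonD)
  have "- 3 = 2 * (- 3 / 2 :: 'a)" using assms(1) by simp
  also have "\<dots> = 2" by (simp only: eq mult_1_right)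
  finally have h: "- 3 = (2::'a)" .
  have "(5::'a) = 3 + 2" by simp
  also have "\<dots> = 3 + - 3" by (simp only: h)
  also have "\<dots> = 0" by (rule right_minus)
  finally have "(5::'a) = 0" .
  with False show False by simp
qed

section \<open>Characteristic 2\<close>

lemma Tr_inverse_f_nonzero:
  assumes "bij_betw f (UNIV - {0}) (UNIV - {0})" "x \<noteq> 0" "Tr (1 / x) \<noteq> 0"
  shows "f x \<noteq> 0" "Tr (1 / f x) \<noteq> 0"
proof -
  show nz: "f x \<noteq> 0" using bij_betw_apply[OF assms(1), of x] assms(2) by simp
  show "Tr (1 / f x) \<noteq> 0"
  proof
    assume "Tr (1 / f x) = 0"
    hence "f (f x) = f x" by (simp add: f_eq[of "f x"])
    hence "f x = x" using bij_betw_imp_inj_on[OF assms(1)] nz assms(2) by (auto simp: inj_on_def)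
    with \<open>Tr (1 / f x) = 0\<close> assms(3) show False by simp
  qed
qed

end

text \<open>
  The unqualified name of the method \<open>Groebner_Basis.algebra\<close> is shadowed by HOL-Algebra.
\<close>

lemma trace_numerator_char_2:
  fixes a b :: "'a::idom"
  assumes "(2::'a) = 0" "a + b + c = 1" "t ^ 4 * (a * b * c) ^ 2 = 1 + (a * b + b * c + c * a)"
  defines "P \<equiv> \<lambda>x. t ^ 2 * x ^ 2 + x - 1"
  shows "a ^ 2 * P b * P c + b ^ 2 * P a * P c + c ^ 2 * P a * P b = 0"
proof -
  have c: "c = 1 - a - b" using assms(2) by (simp add: algebra_simps)
  define e N where "e = a * b + b * c + c * a" and "N = a * b * c"
  \<comment> \<open>The first bracket vanishes by the hypothesis on \<open>t\<close>, the second
    term because 2 = 0.\<close>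
  have "a ^ 2 * P b * P c + b ^ 2 * P a * P c + c ^ 2 * P a * P b
        = 3 * (t ^ 4 * N ^ 2 - (1 + e)) + 2 * (2 + t ^ 2 * (N * e - e ^ 2 + 2 * N) + 2 * N)"
    unfolding P_def e_def N_def c by Groebner_Basis.algebra
  thus ?thesis using assms(1,3) by (simp add: e_def N_def)
qed

context cubic_extension
begin

text \<open>For \<open>v = u ^ q - u\<close> the form is the value of 1 + e_2 at the trace-1 element
  \<open>1 + v\<close>, so this supplies the required element. The form equals
  \<open>v ^ 2 * (1 + w + w ^ 2)\<close> with \<open>w = v ^ (q - 1)\<close>; if it vanished for
  every \<open>u\<close>, then \<open>V * W\<close> would have \<open>q ^ 3\<close> roots, more than
  its degree allows.\<close>

lemma norm_form_nonzero_char_2: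
  assumes "(2::'a) = 0"
  shows "\<exists>u::'a. (u ^ q - u) ^ 2 + (u ^ q - u) * (u ^ q - u) ^ q + ((u ^ q - u) ^ q) ^ 2 \<noteq> 0"
proof (rule ccontr)
  assume *: "\<not> ?thesis"
  define V :: "'a poly" where "V = monom 1 q - monom 1 1"
  define W :: "'a poly" where "W = 1 + V ^ (q - 1) + V ^ (2 * (q - 1))"
  have pV: "poly V u = u ^ q - u" for u
    by (simp add: V_def poly_monom)
  have dV: "degree V \<le> q"
    unfolding V_def using q_gt_1 by (intro degree_diff_le) (auto intro: order.trans[OF degree_monom_le])
  have "coeff V q = 1" using q_gt_1 by (simp add: V_def)
  hence V0: "V \<noteq> 0" by auto
  have "poly W 0 = 1" using q_gt_1 by (simp add: W_def pV power_0_left)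
  hence W0: "W \<noteq> 0" by auto
  have dpow: "degree (V ^ n) \<le> q * n" for n
    by (rule order.trans[OF degree_power_le]) (use dV in simp)
  have dW: "degree W \<le> q * (2 * (q - 1))"
    unfolding W_def
    by (intro degree_add_le order.trans[OF dpow]) auto
  have "poly (V * W) u = 0" for u
  proof -
    let ?v = "u ^ q - u"
    have "?v ^ q = ?v * ?v ^ (q - 1)" using q_gt_1 by (simp flip: power_Suc)
    moreover have "?v ^ 2 + ?v * ?v ^ q + (?v ^ q) ^ 2 = 0" using * by blast
    moreover have "v ^ 2 + v * (v * w) + (v * w) ^ 2 = v ^ 2 * (1 + w + w ^ 2)" for v w :: 'a
      by (simp add: algebra_simps power2_eq_square)
    ultimately have "?v ^ 2 * (1 + ?v ^ (q - 1) + (?v ^ (q - 1)) ^ 2) = 0"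
      by metis
    thus ?thesis by (auto simp: W_def pV power_even_eq simp flip: power_mult)
  qed
  hence "{u. poly (V * W) u = 0} = UNIV" by blast
  hence "q ^ 3 \<le> degree (V * W)"
    using card_poly_roots_bound[of "V * W"] V0 W0 by (simp add: card_field)
  also have "\<dots> \<le> q + q * (2 * (q - 1))"
    using dV dW degree_mult_le[of V W] by linarith
  also have "\<dots> < q * q * 2"
    using q_gt_1 by (cases q) (auto simp: algebra_simps)
  also have "\<dots> \<le> q * q * q" using q_gt_1 by simp
  finally show False by (simp add: power3_eq_cube)
qed

lemma not_bij_CHAR_2:
  assumes two: "(2::'a) = 0" and bij: "bij_betw f (UNIV - {0}) (UNIV - {0})"
  shows False
proof -
  obtain u :: 'a where u: "(u ^ q - u) ^ 2 + (u ^ q - u) * (u ^ q - u) ^ q + ((u ^ q - u) ^ q) ^ 2 \<noteq> 0"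
    using norm_form_nonzero_char_2[OF two] by blast
  \<comment> \<open>An element of this shape has trace 0, so \<open>a\<close> has trace 3 = 1;
    \<open>b\<close> and \<open>c\<close> are its conjugates.\<close>
  define v where "v = u ^ q - u"
  define a where "a = 1 + v"
  define b where "b = a ^ q"
  define c where "c = b ^ q"
  have ca: "c ^ q = a" by (simp add: c_def b_def frob_cubed)
  have vq: "(v ^ q) ^ q = - v - v ^ q"
    by (simp add: v_def frob_diff frob_cubed)
  have b: "b = 1 + v ^ q" and c: "c = 1 - v - v ^ q"
    by (simp_all add: c_def b_def a_def frob_add vq)
  have "a + b + c = 1 + 2"
    by (simp add: a_def b c)
  hence sum: "a + b + c = 1" using two by simp
  have "1 + (a * b + b * c + c * a) = v ^ 2 + v * v ^ q + (v ^ q) ^ 2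
          + 2 * (2 - v ^ 2 - v * v ^ q - (v ^ q) ^ 2)"
    unfolding a_def b c by (simp add: algebra_simps power2_eq_square)
  hence "1 + (a * b + b * c + c * a) = v ^ 2 + v * v ^ q + (v ^ q) ^ 2"
    using two by simp
  hence e: "1 + (a * b + b * c + c * a) \<noteq> 0"
    using u by (simp add: v_def)
  have nz: "a \<noteq> 0" "b \<noteq> 0" "c \<noteq> 0"
    using sum ca q_gt_1 by (auto simp: b_def c_def power_0_left split: if_splits)
  define N where "N = a * b * c"
  have N: "N \<noteq> 0" "N ^ q = N"
    using nz by (simp_all add: N_def power_mult_distrib ca flip: b_def c_def)
  have inj2: "inj (\<lambda>x::'a. x ^ 2)"
  proof (rule injI)
    fix x y :: 'a assume "x ^ 2 = y ^ 2"
    hence "(x - y) ^ 2 = 2 * (y ^ 2 - x * y)"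
      by (simp add: power2_diff algebra_simps)
    hence "(x - y) ^ 2 = 0" using two by simp
    thus "x = y" by simp
  qed
  have inj4: "inj (\<lambda>x::'a. x ^ 4)"
    using inj_compose[OF inj2 inj2] by (simp add: o_def flip: power_mult)
  have "surj (\<lambda>x::'a. x ^ 4)"
    using finite_UNIV_inj_surj[OF _ inj4] by simp
  then obtain t :: 'a where t: "t ^ 4 = (1 + (a * b + b * c + c * a)) / N ^ 2"
    by (metis surjD)
  \<comment> \<open>\<open>t ^ 4\<close> is fixed by Frobenius, and fourth roots are unique, so
    \<open>t\<close> lies in the subfield.\<close>
  have "(t ^ q) ^ 4 = (t ^ 4) ^ q" by (simp add: mult.commute flip: power_mult)
  also have "(N ^ 2) ^ q = N ^ 2"
    using N(2) by (simp add: power2_eq_square power_mult_distrib)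
  hence "(t ^ 4) ^ q = t ^ 4"
    by (simp add: t power_divide frob_add power_mult_distrib ca flip: b_def c_def)
  finally have tq: "t ^ q = t" using inj4 by (auto dest: injD)
  have t0: "t \<noteq> 0" using t e N by auto
  have t4: "t ^ 4 * (a * b * c) ^ 2 = 1 + (a * b + b * c + c * a)"
    using t N by (simp add: N_def)
  \<comment> \<open>\<open>P a\<close> is the numerator of \<open>f x\<close> at
    \<open>x = 1 / (t * a)\<close>, a point chosen so that \<open>Tr (1 / x) = t\<close>.\<close>
  define P where "P = (\<lambda>x. t ^ 2 * x ^ 2 + x - 1)"
  define x where "x = 1 / (t * a)"
  have x: "x \<noteq> 0" "1 / x = t * a" using nz t0 by (auto simp: x_def)
  have "Tr a = 1" using sum by (simp add: Tr_eq c_def b_def)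
  hence Trx: "Tr (1 / x) = t" by (simp add: x Tr_scale tq)
  note fx = Tr_inverse_f_nonzero[OF bij x(1), unfolded Trx, OF t0]
  have "f x = (1 - x ^ 2) * t + x" by (simp only: f_eq Trx)
  also have "\<dots> = P a / (t * a ^ 2)"
    using nz t0 unfolding x_def P_def
    by (simp add: field_simps power2_eq_square)
  finally have "f x = P a / (t * a ^ 2)" .
  hence inv: "1 / f x = t * (a ^ 2 / P a)" and Pa: "P a \<noteq> 0"
    using fx by auto
  have Pq: "P z ^ q = P (z ^ q)" for z
    by (simp add: P_def frob_diff frob_add power_mult_distrib tq mult.commute[of 2]
             flip: power_mult)
       (simp add: power_mult tq)
  have Pb: "P b = P a ^ q" and Pc: "P c = P b ^ q"
    by (simp_all add: Pq b_def c_def)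
  hence Pbc: "P b \<noteq> 0" "P c \<noteq> 0" using Pa by auto
  have sq: "(z ^ 2) ^ q = (z ^ q) ^ (2::nat)" for z :: 'a
    by (simp add: mult.commute flip: power_mult)
  have "Tr (a ^ 2 / P a) = a ^ 2 / P a + b ^ 2 / P b + c ^ 2 / P c"
    by (simp add: Tr_eq power_divide sq Pb Pc flip: b_def c_def)
  also have "\<dots> = (a ^ 2 * P b * P c + b ^ 2 * P a * P c + c ^ 2 * P a * P b) / (P a * P b * P c)"
    using Pa Pbc by (simp add: field_simps)
  also have "\<dots> = 0"
    using trace_numerator_char_2[OF two sum t4] by (simp add: P_def)
  finally have "Tr (1 / f x) = 0"
    unfolding inv Tr_scale[OF tq] by simp
  with fx show False by simp
qed

end

section \<open>Characteristic 3 with q at least 9: Laurent expansion and power sums\<close>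

text \<open>
  A tuple \<open>(c, i, j, k)\<close> encodes the Laurent monomial $c z^{i + jq + kq^2}$.
\<close>

type_synonym laurent_term = "int \<times> int \<times> int \<times> int"

fun term_val :: "nat \<Rightarrow> laurent_term \<Rightarrow> 'a::field \<Rightarrow> 'a" where
  "term_val q (c, i, j, k) z = of_int c * z powi (i + j * int q + k * int q ^ 2)"

fun term_mult :: "laurent_term \<Rightarrow> laurent_term \<Rightarrow> laurent_term" where
  "term_mult (c, i, j, k) (c', i', j', k') = (c * c', i + i', j + j', k + k')"

definition laurent_mult :: "laurent_term list \<Rightarrow> laurent_term list \<Rightarrow> laurent_term list" where
  "laurent_mult L M = concat (map (\<lambda>l. map (term_mult l) M) L)"

definition laurent_val :: "nat \<Rightarrow> laurent_term list \<Rightarrow> 'a::field \<Rightarrow> 'a" where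
  "laurent_val q L z = (\<Sum>m\<leftarrow>L. term_val q m z)"

fun const_coeff :: "laurent_term \<Rightarrow> int" where
  "const_coeff (c, i, j, k) = (if i = 0 \<and> j = 0 \<and> k = 0 then c else 0)"

fun small_exponents :: "laurent_term \<Rightarrow> bool" where
  "small_exponents (c, i, j, k) \<longleftrightarrow> \<bar>i\<bar> \<le> 4 \<and> \<bar>j\<bar> \<le> 4 \<and> \<bar>k\<bar> \<le> 4"

text \<open>The expansion of \<open>f (1 / z)\<close>: the term -1/z coming from the trace cancels
  the summand 1/z.\<close>

definition f_terms :: "laurent_term list" where
  "f_terms = [(1, 1, 0, 0), (1, 0, 1, 0), (1, 0, 0, 1), (-1, -2, 1, 0), (-1, -2, 0, 1)]"

text \<open>The Frobenius image of \<open>f_terms\<close>: exponents shift cyclically, because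
  \<open>z ^ (q ^ 3) = z\<close>.\<close>

definition f_frob_terms :: "laurent_term list" where
  "f_frob_terms = [(1, 1, 0, 0), (1, 0, 1, 0), (1, 0, 0, 1), (-1, 0, -2, 1), (-1, 1, -2, 0)]"

text \<open>Represents \<open>f (1 / z) ^ (2 + 2 * q)\<close>.\<close>

definition product_terms :: "laurent_term list" where
  "product_terms = laurent_mult (laurent_mult f_terms f_terms) (laurent_mult f_frob_terms f_frob_terms)"

lemma product_terms_small: "list_all small_exponents product_terms"
  by code_simp

text \<open>The power sum will be minus this number; 8 is -1 modulo 3, hence nonzero in
  characteristic 3.\<close>

lemma product_terms_const: "(\<Sum>m\<leftarrow>product_terms. const_coeff m) = 8"
  by code_simp

lemma term_val_mult: "z \<noteq> 0 \<Longrightarrow> term_val q (term_mult l m) z = term_val q l z * term_val q m z"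
  by (cases l; cases m) (auto simp: power_int_add algebra_simps simp flip: power_int_add)

lemma laurent_val_mult:
  assumes "z \<noteq> 0"
  shows "laurent_val q (laurent_mult L M) z = laurent_val q L z * laurent_val q M z"
proof (induction L)
  case (Cons l L)
  have "(\<Sum>m\<leftarrow>M. term_val q (term_mult l m) z) = term_val q l z * (\<Sum>m\<leftarrow>M. term_val q m z)"
    using assms by (simp add: term_val_mult sum_list_const_mult)
  with Cons show ?case
    by (simp add: laurent_val_def laurent_mult_def o_def algebra_simps)
qed (simp add: laurent_val_def laurent_mult_def)

text \<open>The exponent is too small in absolute value to be a nonzero multiple of
  \<open>Q ^ 3 - 1\<close>. Once it is 0, reducing modulo \<open>Q\<close> kills the digits one
  after another, since each is below \<open>Q\<close> in absolute value.\<close>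

lemma small_exponents_dvd_iff:
  fixes i j k Q :: int
  assumes "\<bar>i\<bar> \<le> 4" "\<bar>j\<bar> \<le> 4" "\<bar>k\<bar> \<le> 4" "Q \<ge> 9"
  shows "Q ^ 3 - 1 dvd i + j * Q + k * Q ^ 2 \<longleftrightarrow> i = 0 \<and> j = 0 \<and> k = 0"
proof
  assume dvd: "Q ^ 3 - 1 dvd i + j * Q + k * Q ^ 2"
  have Q2: "Q ^ 2 \<ge> 0" by simp
  have "\<bar>i + j * Q + k * Q ^ 2\<bar> \<le> \<bar>i\<bar> + \<bar>j * Q\<bar> + \<bar>k * Q ^ 2\<bar>"
    by linarith
  also have "\<dots> \<le> 4 + 4 * Q + 4 * Q ^ 2"
    using assms by (intro add_mono) (auto simp: abs_mult intro!: mult_right_mono)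
  \<comment> \<open>The factor 8 is where \<open>Q \<ge> 9\<close> enters, as
    \<open>8 \<le> Q - 1\<close>.\<close>
  also have "\<dots> < 8 * (1 + Q + Q ^ 2)"
    using assms(4) by (simp add: algebra_simps add_pos_nonneg)
  also have "\<dots> \<le> (Q - 1) * (1 + Q + Q ^ 2)"
    using assms(4) Q2 by (intro mult_right_mono) auto
  also have "\<dots> = Q ^ 3 - 1" by (simp add: algebra_simps eval_nat_numeral)
  finally have "\<bar>i + j * Q + k * Q ^ 2\<bar> < Q ^ 3 - 1" .
  hence 0: "i + j * Q + k * Q ^ 2 = 0"
    using dvd zdvd_not_zless[of "\<bar>i + j * Q + k * Q ^ 2\<bar>" "Q ^ 3 - 1"] by auto
  have zero: "n = 0" if "\<bar>n\<bar> \<le> 4" "Q dvd n" for n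
    using that assms(4) zdvd_not_zless[of "\<bar>n\<bar>" Q] by auto
  have "i = Q * (- j - k * Q)" using 0 by (simp add: algebra_simps power2_eq_square)
  hence i: "i = 0" using assms(1) zero by (metis dvd_triv_left)
  with 0 have "Q * (j + k * Q) = 0" by (simp add: algebra_simps power2_eq_square)
  hence jk: "j + k * Q = 0" using assms(4) by simp
  hence "j = Q * (- k)" by (simp add: algebra_simps)
  hence "j = 0" using assms(2) zero by (metis dvd_triv_left)
  with i jk assms(4) show "i = 0 \<and> j = 0 \<and> k = 0" by simp
qed simp

context cubic_extension
begin

text \<open>Summing over the units kills every monomial whose exponent is not a multiple of
  \<open>q ^ 3 - 1\<close>, so among small exponents only the constant terms survive, each with
  factor -1.\<close>

lemma sum_laurent_val:
  assumes "q \<ge> 9" "list_all small_exponents L"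
  shows "(\<Sum>z\<in>UNIV - {0}. laurent_val q L z) = (- of_int (\<Sum>m\<leftarrow>L. const_coeff m) :: 'a)"
  using assms(2)
proof (induction L)
  case (Cons m L)
  obtain c i j k where m: "m = (c, i, j, k)" by (cases m)
  have "int (CARD('a) - 1) = int q ^ 3 - 1"
    using q_gt_1 by (simp add: card_field of_nat_diff)
  hence "(\<Sum>z\<in>UNIV - {0}. term_val q m z) = (- of_int (const_coeff m) :: 'a)"
    using Cons.prems assms(1) small_exponents_dvd_iff[of i j k "int q"]
    by (simp add: m sum_powi_units flip: sum_distrib_left)
  with Cons show ?case
    by (simp add: laurent_val_def sum.distrib)
qed (simp add: laurent_val_def)

lemma f_laurent:
  assumes "x \<noteq> 0"
  shows "f (1 / x) = laurent_val q f_terms x" "f (1 / x) ^ q = laurent_val q f_frob_terms x"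
proof -
  define y z where "y = x ^ q" and "z = y ^ q"
  have nz: "y \<noteq> 0" "z \<noteq> 0" using assms by (auto simp: y_def z_def)
  have z_pow: "x ^ (q ^ 2) = z" by (simp add: y_def z_def power2_eq_square power_mult)
  have pw: "x powi (i + j * int q + k * int q ^ 2) = x powi i * y powi j * z powi k" for i j k
  proof -
    have "x powi (int n * l) = (x ^ n) powi l" for n l
      by (simp only: power_int_mult power_int_of_nat)
    from this[of q j] this[of "q ^ 2" k]
    have "x powi (j * int q) = y powi j" "x powi (k * int q ^ 2) = z powi k"
      by (simp_all only: z_pow y_def of_nat_power mult.commute)
    thus ?thesis using assms by (simp add: power_int_add)
  qed
  have val: "term_val q (c, i, j, k) x = of_int c * (x powi i * y powi j * z powi k)" for c i j k
    by (simp only: term_val.simps pw)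
  have Tr: "Tr x = x + y + z" by (simp add: Tr_eq y_def z_def)
  have f: "f (1 / x) = (1 - 1 / x ^ 2) * (x + y + z) + 1 / x"
    by (simp add: f_eq Tr power_divide)
  show "f (1 / x) = laurent_val q f_terms x"
    using assms unfolding f laurent_val_def f_terms_def
    by (simp add: val power_int_minus del: term_val.simps) (simp add: field_simps power2_eq_square)
  have "f (1 / x) ^ q = (1 - (1 / y) ^ 2) * (x + y + z) + 1 / y"
    using frob_Tr[of x]
    by (simp add: f_eq frob_add frob_diff power_mult_distrib Tr power_divide y_def
          flip: power_mult) (simp add: mult.commute)
  thus "f (1 / x) ^ q = laurent_val q f_frob_terms x"
    using nz unfolding laurent_val_def f_frob_terms_def
    by (simp add: val power_int_minus del: term_val.simps) (simp add: field_simps power2_eq_square)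
qed

lemma not_bij_CHAR_3:
  assumes three: "(3::'a) = 0" and q: "q \<ge> 9" and bij: "bij_betw f (UNIV - {0}) (UNIV - {0})"
  shows False
proof -
  let ?U = "UNIV - {0::'a}"
  have "(\<Sum>x\<in>?U. x ^ (2 + 2 * q)) = (\<Sum>x\<in>?U. f x ^ (2 + 2 * q))"
    using sum.reindex_bij_betw[OF bij, of "\<lambda>x. x ^ (2 + 2 * q)"] by simp
  \<comment> \<open>Inverting the argument turns the trace of the inverse into a sum of three
    monomials.\<close>
  also have "\<dots> = (\<Sum>x\<in>?U. f (1 / x) ^ (2 + 2 * q))"
    by (rule sum.reindex_bij_witness[of _ "\<lambda>x. 1 / x" "\<lambda>x. 1 / x"]) auto
  also have "\<dots> = (\<Sum>x\<in>?U. laurent_val q product_terms x)"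
  proof (rule sum.cong)
    fix x :: 'a assume x: "x \<in> ?U"
    have "f (1 / x) ^ (2 + 2 * q) = (f (1 / x)) ^ 2 * (f (1 / x) ^ q) ^ 2"
      by (simp only: power_add mult.commute[of 2 q] power_mult)
    also have "\<dots> = laurent_val q product_terms x"
      using x f_laurent[of x]
      by (simp add: product_terms_def laurent_val_mult power2_eq_square mult.assoc)
    finally show "f (1 / x) ^ (2 + 2 * q) = laurent_val q product_terms x" .
  qed simp
  also have "\<dots> = - 8"
    using sum_laurent_val[OF q product_terms_small] by (simp add: product_terms_const)
  finally have "(\<Sum>x\<in>?U. x ^ (2 + 2 * q)) = - 8" .
  moreover have "(\<Sum>x\<in>?U. x ^ (2 + 2 * q)) = 0"
  proof -
    have "(\<Sum>x\<in>?U. x powi (2 + 2 * int q + 0 * int q ^ 2)) = (0::'a)"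
      using small_exponents_dvd_iff[of 2 2 0 "int q"] q q_gt_1
      by (subst sum_powi_units) (simp add: card_field of_nat_diff)
    moreover have "x powi (2 + 2 * int q + 0 * int q ^ 2) = x ^ (2 + 2 * q)" for x :: 'a
      by (simp flip: power_int_of_nat)
    ultimately show ?thesis by simp
  qed
  ultimately have "(8::'a) = 0" by simp
  hence "3 * 3 - (8::'a) = 0" unfolding three by simp
  thus False by simp
qed

end

section \<open>Bijectivity for q = 3\<close>

context cubic_extension
begin

text \<open>
  In characteristic 3 the product of the three cubics is $X^9 - X^8 - X^6 - 1$, and each of them
  cuts out an orbit of the Frobenius map.  The cofactors of 3 below turn the congruences modulo 3
  between these polynomials into identities over the integers.
\<close>

definition orbitA :: "'a \<Rightarrow> bool" where "orbitA x \<longleftrightarrow> x ^ 3 + x ^ 2 + x - 1 = 0"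
definition orbitB :: "'a \<Rightarrow> bool" where "orbitB x \<longleftrightarrow> x ^ 3 + x ^ 2 - x + 1 = 0"
definition orbitC :: "'a \<Rightarrow> bool" where "orbitC x \<longleftrightarrow> x ^ 3 - x + 1 = 0"

context
  assumes three: "(3::'a) = 0" and q3: "q = 3"
begin

lemma Tr_inverse_eq_iff:
  assumes "x \<noteq> 0"
  shows "Tr (1 / x) = t \<longleftrightarrow> x ^ 8 + x ^ 6 + 1 = t * x ^ 9"
proof -
  have "x ^ 9 * (y + y ^ 3 + (y ^ 3) ^ 3) = x ^ 8 * (x * y) + x ^ 6 * (x * y) ^ 3 + (x * y) ^ 9" for y
    by Groebner_Basis.algebra
  from this[of "1 / x"] have "x ^ 9 * Tr (1 / x) = x ^ 8 + x ^ 6 + 1"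
    using assms Tr_eq[of "1 / x"] by (simp add: q3)
  thus ?thesis using assms by (auto simp: mult.commute)
qed

lemma Tr_inverse_eq_1_iff:
  assumes "x \<noteq> 0"
  shows "Tr (1 / x) = 1 \<longleftrightarrow> orbitA x \<or> orbitB x \<or> orbitC x"
proof -
  have "x ^ 9 - (x ^ 8 + x ^ 6 + 1)
        = (x ^ 3 + x ^ 2 + x - 1) * (x ^ 3 + x ^ 2 - x + 1) * (x ^ 3 - x + 1)
          + 3 * (- (x ^ 8) - x ^ 4 + x ^ 2 - x)"
    by Groebner_Basis.algebra
  hence "x ^ 9 - (x ^ 8 + x ^ 6 + 1)
        = (x ^ 3 + x ^ 2 + x - 1) * (x ^ 3 + x ^ 2 - x + 1) * (x ^ 3 - x + 1)"
    by (simp only: three mult_zero_left add_0_right)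
  moreover have "Tr (1 / x) = 1 \<longleftrightarrow> x ^ 9 - (x ^ 8 + x ^ 6 + 1) = 0"
    using assms by (auto simp: Tr_inverse_eq_iff)
  ultimately show ?thesis by (simp add: orbitA_def orbitB_def orbitC_def)
qed

lemma Tr_values: "Tr y \<in> {0, 1, - 1}"
proof -
  let ?t = "Tr y"
  have "?t ^ 3 = ?t" using frob_Tr[of y] by (simp add: q3)
  moreover have "?t ^ 3 - ?t = ?t * (?t - 1) * (?t + 1)"
    by (simp add: algebra_simps power3_eq_cube)
  ultimately have "?t * (?t - 1) * (?t + 1) = 0" by simp
  thus ?thesis by (auto simp: eq_neg_iff_add_eq_0)
qed

lemma one_neq_minus_one: "(1::'a) \<noteq> - 1"
proof
  assume "(1::'a) = - 1"
  hence "(1::'a) + 1 = 0" by (simp add: eq_neg_iff_add_eq_0)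
  with three have "(3::'a) - (1 + 1) = 0" by simp
  thus False by simp
qed

text \<open>Modulo 3, a common root of two of the cubics could only be 1, -1 or 0 respectively, and
  none of these is one.\<close>

lemma orbits_disjoint:
  "\<not> (orbitA x \<and> orbitB x)" "\<not> (orbitA x \<and> orbitC x)" "\<not> (orbitB x \<and> orbitC x)"
proof -
  have "x = 1" if "orbitA x" "orbitB x"
  proof -
    have "x - 1 = (x ^ 3 + x ^ 2 - x + 1) - (x ^ 3 + x ^ 2 + x - 1) + 3 * (x - 1)"
      by Groebner_Basis.algebra
    hence "x - 1 = 0" using that by (simp only: orbitA_def orbitB_def three) simp
    thus ?thesis by simp
  qed
  moreover have "x = - 1" if "orbitA x" "orbitC x"
  proof -
    have "(x + 1) ^ 2 = (x ^ 3 + x ^ 2 + x - 1) - (x ^ 3 - x + 1) + 3"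
      by Groebner_Basis.algebra
    hence "(x + 1) ^ 2 = 0" using that by (simp only: orbitA_def orbitC_def three) simp
    thus ?thesis by (simp add: eq_neg_iff_add_eq_0)
  qed
  moreover have "x = 0" if "orbitB x" "orbitC x"
  proof -
    have "x ^ 2 = (x ^ 3 + x ^ 2 - x + 1) - (x ^ 3 - x + 1)" by simp
    hence "x ^ 2 = 0" using that by (simp only: orbitB_def orbitC_def) simp
    thus ?thesis by simp
  qed
  ultimately show
    "\<not> (orbitA x \<and> orbitB x)" "\<not> (orbitA x \<and> orbitC x)" "\<not> (orbitB x \<and> orbitC x)"
    using one_neq_minus_one by (auto simp: orbitA_def orbitB_def orbitC_def)
qed

text \<open>\<open>F\<close> is the form of \<open>f\<close> where the inverse has trace 1. Modulo
  3, each target cubic composed with \<open>F\<close> or \<open>- F\<close> is a multiple of the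
  source cubic.\<close>

lemma orbits_f:
  defines "F \<equiv> \<lambda>x::'a. 1 + x - x ^ 2"
  shows "orbitA x \<Longrightarrow> orbitC (F x)" "orbitB x \<Longrightarrow> orbitA (F x)" "orbitC x \<Longrightarrow> orbitB (- F x)"
proof -
  have "F x ^ 3 - F x + 1
      = (x ^ 3 + x ^ 2 + x - 1) * (- (x ^ 3) + 4 * x ^ 2 - 3 * x - 7) + 3 * (5 * x ^ 2 + 2 * x - 2)"
    unfolding F_def by Groebner_Basis.algebra
  thus "orbitC (F x)" if "orbitA x"
    using that by (simp only: orbitA_def orbitC_def three) simp
  have "F x ^ 3 + F x ^ 2 + F x - 1
      = (x ^ 3 + x ^ 2 - x + 1) * (- (x ^ 3) + 4 * x ^ 2 - 4 * x + 2) + 3 * (- 4 * x ^ 2 + 4 * x)"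
    unfolding F_def by Groebner_Basis.algebra
  thus "orbitA (F x)" if "orbitB x"
    using that by (simp only: orbitA_def orbitB_def three) simp
  have "(- F x) ^ 3 + (- F x) ^ 2 - (- F x) + 1
      = (x ^ 3 - x + 1) * (x ^ 3 - 3 * x ^ 2 + 2 * x - 1) + 3 * (x ^ 2 - x + 1)"
    unfolding F_def by Groebner_Basis.algebra
  thus "orbitB (- F x)" if "orbitC x"
    using that by (simp only: orbitB_def orbitC_def three) simp
qed

text \<open>Since \<open>F v - F w = (v - w) * (1 - v - w)\<close>, this excludes collisions of
  \<open>F\<close> within one orbit. Modulo 3 the two equations force \<open>x = -1\<close>,
  \<open>x\<close> in {0, 1}, and -1 = 0 respectively, all contradictory.\<close>

lemma orbits_reflect:
  "\<not> (orbitA x \<and> orbitA (1 - x))" "\<not> (orbitB x \<and> orbitB (1 - x))" "\<not> (orbitC x \<and> orbitC (1 - x))"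
proof -
  show "\<not> (orbitA x \<and> orbitA (1 - x))"
  proof
    define A where "A = (\<lambda>x::'a. x ^ 3 + x ^ 2 + x - 1)"
    assume "orbitA x \<and> orbitA (1 - x)"
    hence A: "A x = 0" "A (1 - x) = 0" by (simp_all add: A_def orbitA_def)
    have "x + 1 = A x + (x + 2) * (A x + A (1 - x)) + 3 * (- 2 * x ^ 3 - 2 * x ^ 2 + 3 * x)"
      unfolding A_def by Groebner_Basis.algebra
    hence "x + 1 = 0" by (simp only: A three) simp
    hence "x = - 1" by (simp add: eq_neg_iff_add_eq_0)
    with A one_neq_minus_one show False by (simp add: A_def)
  qed
  show "\<not> (orbitB x \<and> orbitB (1 - x))"
  proof
    define B where "B = (\<lambda>x::'a. x ^ 3 + x ^ 2 - x + 1)"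
    assume "orbitB x \<and> orbitB (1 - x)"
    hence B: "B x = 0" "B (1 - x) = 0" by (simp_all add: B_def orbitB_def)
    have "x * (1 - x) = B x + B (1 - x) + 3 * (- 2 * x ^ 2 + 2 * x - 1)"
      unfolding B_def by Groebner_Basis.algebra
    hence "x * (1 - x) = 0" by (simp only: B three) simp
    hence "x = 0 \<or> x = 1" by simp
    with B one_neq_minus_one show False by (auto simp: B_def)
  qed
  show "\<not> (orbitC x \<and> orbitC (1 - x))"
  proof
    define C where "C = (\<lambda>x::'a. x ^ 3 - x + 1)"
    assume "orbitC x \<and> orbitC (1 - x)"
    hence C: "C x = 0" "C (1 - x) = 0" by (simp_all add: C_def orbitC_def)
    have "- 1 = C x + C (1 - x) + 3 * (- (x ^ 2) + x - 1)"
      unfolding C_def by Groebner_Basis.algebra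
    hence "- 1 = (0::'a)" by (simp only: C three) simp
    thus False by simp
  qed
qed

text \<open>The trace takes only the values 0, 1 and -1. As \<open>f\<close> is odd, trace -1
  reduces to trace 1 at \<open>- x\<close>; the sign \<open>s\<close> is the trace itself.\<close>

lemma f_cases:
  assumes "x \<noteq> 0"
  obtains "Tr (1 / x) = 0" "f x = x"
  | s where "s \<in> {1, - 1}" "Tr (1 / (s * x)) = 1" "f x = s * (1 + s * x - (s * x) ^ 2)"
proof -
  have neg: "Tr (1 / (- x)) = - Tr (1 / x)"
    using Tr_scale[of "-1" "1 / x"] by (simp add: frob_minus)
  consider "Tr (1 / x) = 0" | "Tr (1 / x) = 1" | "Tr (1 / x) = - 1"
    using Tr_values[of "1 / x"] by blast
  thus thesis
  proof cases
    case 1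
    thus thesis by (intro that(1)) (simp_all add: f_eq)
  next
    case 2
    thus thesis by (intro that(2)[of 1]) (simp_all add: f_eq)
  next
    case 3
    thus thesis by (intro that(2)[of "-1"]) (simp_all add: f_eq neg[simplified])
  qed
qed

text \<open>By \<open>orbits_f\<close>, orbits A and B are sent to orbits of trace 1, while C is
  sent to the negative of B. So the sign of the trace flips exactly on C, and the trace stays
  nonzero.\<close>

lemma Tr_inverse_f_scaled:
  assumes "s \<in> {1, - 1}" "Tr (1 / (s * x)) = 1" "f x = s * (1 + s * x - (s * x) ^ 2)" "x \<noteq> 0"
  shows "f x \<noteq> 0" "Tr (1 / f x) \<noteq> 0"
    "Tr (1 / f x) = (if orbitC (s * x) then - s else s)"
proof -
  define w where "w = s * x"
  define F where "F = 1 + w - w ^ 2"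
  have f: "f x = s * F" using assms(3) by (simp add: w_def F_def)
  have s: "s \<noteq> 0" "1 / s = s" "s ^ q = s"
    using assms(1) q_gt_1 by (auto simp: frob_minus)
  have w: "w \<noteq> 0" "Tr (1 / w) = 1" using assms s by (auto simp: w_def)
  have Tr: "Tr (1 / (s * y)) = s * Tr (1 / y)" if "s \<in> {1, - 1}" for s y
    using that Tr_scale[of "-1" "1 / y"] by (auto simp: frob_minus)
  have *: "Tr (1 / F) = (if orbitC w then - 1 else 1) \<and> F \<noteq> 0"
  proof (cases "orbitC w")
    case True
    hence B: "orbitB (- F)" using orbits_f(3) by (simp add: F_def)
    hence "- F \<noteq> 0" unfolding orbitB_def by (metis add_0 diff_zero power_zero_numeral zero_neq_one)
    moreover from this have "Tr (1 / (- F)) = 1" using B Tr_inverse_eq_1_iff by blast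
    ultimately show ?thesis using True Tr[of "-1" F] by (simp add: minus_equation_iff)
  next
    case False
    hence "orbitA w \<or> orbitB w" using Tr_inverse_eq_1_iff[OF w(1)] w(2) by blast
    hence AC: "orbitC F \<or> orbitA F" using orbits_f unfolding F_def by blast
    hence "F \<noteq> 0" by (auto simp: orbitA_def orbitC_def)
    thus ?thesis using False AC Tr_inverse_eq_1_iff by auto
  qed
  show "f x \<noteq> 0" using * s f by simp
  show "Tr (1 / f x) = (if orbitC (s * x) then - s else s)"
    using * Tr[OF assms(1), of F] by (simp add: f w_def)
  thus "Tr (1 / f x) \<noteq> 0" using s by (simp split: if_splits)
qed

lemma f_inj:
  assumes "x \<noteq> 0" "y \<noteq> 0" "f x = f y"
  shows "x = y"
proof (cases rule: f_cases[OF assms(1)])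
  case 1
  note x = this
  show ?thesis
  proof (cases rule: f_cases[OF assms(2)])
    case 1
    with x assms(3) show ?thesis by simp
  next
    case (2 r)
    with x assms(3) show ?thesis using Tr_inverse_f_scaled(2)[OF 2 assms(2)] by simp
  qed
next
  case (2 s)
  note x = this
  show ?thesis
  proof (cases rule: f_cases[OF assms(2)])
    case 1
    thus ?thesis using Tr_inverse_f_scaled(2)[OF x assms(1)] assms(3) by simp
  next
    case (2 r)
    note y = this
    define v w where "v = s * x" and "w = r * y"
    define F where "F = (\<lambda>x::'a. 1 + x - x ^ 2)"
    have sr: "s * s = 1" "r * r = 1" "s \<noteq> 0" using x(1) y(1) by auto
    have vw: "v \<noteq> 0" "w \<noteq> 0" "Tr (1 / v) = 1" "Tr (1 / w) = 1"
      using x y assms(1,2) by (auto simp: v_def w_def)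
    have eq: "s * F v = r * F w"
      using x(3) y(3) assms(3) by (simp add: F_def v_def w_def)
    have Treq: "(if orbitC v then - s else s) = (if orbitC w then - r else r)"
      using Tr_inverse_f_scaled(3)[OF x assms(1)] Tr_inverse_f_scaled(3)[OF y assms(2)] assms(3)
      by (simp add: v_def w_def)
    have v: "orbitA v \<or> orbitB v \<or> orbitC v" and w: "orbitA w \<or> orbitB w \<or> orbitC w"
      using vw Tr_inverse_eq_1_iff by blast+
    have F: "F z = 1 + z - z ^ 2" for z by (simp add: F_def)
    note img = orbits_f[folded F]
    \<comment> \<open>Sign and orbit can be recovered from the common value of
      \<open>f\<close>.\<close>
    have same: "orbitA v = orbitA w \<and> orbitB v = orbitB w \<and> orbitC v = orbitC w \<and> s = r"
    proof (cases "s = r")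
      case True
      hence "F v = F w" using eq sr by simp
      moreover have "orbitC v = orbitC w" using Treq True x(1) one_neq_minus_one by (auto split: if_splits)
      \<comment> \<open>With C settled by the trace, A and B are told apart by whether the image
        lies in C.\<close>
      moreover have "orbitA z \<longleftrightarrow> \<not> orbitC z \<and> orbitC (F z)" "orbitB z \<longleftrightarrow> \<not> orbitC z \<and> \<not> orbitC (F z)"
        if "orbitA z \<or> orbitB z \<or> orbitC z" for z
        using that img(1,2)[of z] orbits_disjoint[of z] orbits_disjoint(2)[of "F z"] by blast+
      ultimately show ?thesis using True v w by metis
    next
      case False
      hence r: "r = - s" using x(1) y(1) by auto
      hence "s * F v = s * (- F w)" using eq by simp
      hence "F v = - F w" using sr(3) mult_left_cancel by blast
      hence FF: "F v = - F w" "F w = - F v" by simp_all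
      have C: "orbitC v \<noteq> orbitC w" using Treq r x(1) one_neq_minus_one by (auto split: if_splits)
      \<comment> \<open>With opposite signs exactly one of \<open>v\<close>, \<open>w\<close> lies
        in C. Its negated image is in B, whereas the other image is in C or A.\<close>
      have "\<not> orbitC y" if "orbitA z \<or> orbitB z" "F z = - F y" for y z
        using that img(1,2)[of z] img(3)[of y] orbits_disjoint[of "F z"] by metis
      hence False using v w C FF by blast
      thus ?thesis ..
    qed
    have "(v - w) * (1 - v - w) = F v - F w"
      by (simp add: F_def algebra_simps power2_eq_square)
    also have "\<dots> = 0" using eq same sr by simp
    finally have "v = w \<or> w = 1 - v" unfolding mult_eq_0_iff by auto
    moreover have "w \<noteq> 1 - v" using v same orbits_reflect[of v] by metis
    ultimately have "s * x = s * y" using same unfolding v_def w_def by blast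
    thus ?thesis using sr(3) mult_left_cancel by blast
  qed
qed

lemma bij_CHAR_3: "bij_betw f (UNIV - {0}) (UNIV - {0})"
proof -
  have inj: "inj_on f (UNIV - {0})"
  proof (rule inj_onI)
    fix x y assume "x \<in> UNIV - {0}" "y \<in> UNIV - {0}" "f x = f y"
    thus "x = y" using f_inj[of x y] by blast
  qed
  have nz: "f x \<noteq> 0" if x: "x \<noteq> 0" for x
  proof (cases rule: f_cases[OF x])
    case 1
    with x show ?thesis by simp
  next
    case (2 s)
    show ?thesis by (rule Tr_inverse_f_scaled(1)[OF 2 x])
  qed
  have "f ` (UNIV - {0}) \<subseteq> UNIV - {0}"
  proof (rule image_subsetI)
    fix x :: 'a assume "x \<in> UNIV - {0}"
    thus "f x \<in> UNIV - {0}" using nz[of x] by simp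
  qed
  hence "f ` (UNIV - {0}) = UNIV - {0}" by (rule endo_inj_surj[OF finite _ inj])
  with inj show ?thesis by (simp only: bij_betw_def)
qed

end

end

section \<open>Case distinction on the characteristic\<close>

theorem theorem4p1:
  fixes q :: nat
  assumes "primepow q"
    and "CARD('a::{field, finite}) = q ^ 3"
  shows "bij_betw (trace_map q :: 'a \<Rightarrow> 'a) (UNIV - {0}) (UNIV - {0}) \<longleftrightarrow> q = 3"
proof
  interpret cubic_extension q "TYPE('a)"
    by unfold_locales (fact assms)+
  assume bij: "bij_betw (trace_map q :: 'a \<Rightarrow> 'a) (UNIV - {0}) (UNIV - {0})"
  have eq_0_iff: "(of_nat p :: 'a) = 0 \<longleftrightarrow> CHAR('a) = p" if "prime p" for p
    using that prime_CHAR by (auto simp: of_nat_eq_0_iff_char_dvd primes_dvd_imp_eq)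
  have "(2::'a) \<noteq> 0" using not_bij_CHAR_2 bij by blast
  hence three: "(3::'a) = 0" using not_bij_CHAR_ge_5 bij by blast
  hence "CHAR('a) = 3" using eq_0_iff[of 3] by simp
  then obtain k where k: "k > 0" "q = 3 ^ k" using q_power_CHAR by auto
  have "\<not> k \<ge> 2"
  proof
    assume "k \<ge> 2"
    hence "(3::nat) ^ 2 \<le> 3 ^ k" by (intro power_increasing) auto
    thus False using not_bij_CHAR_3[OF three _ bij] k(2) by simp
  qed
  with k show "q = 3" by (cases k) auto
next
  interpret cubic_extension q "TYPE('a)"
    by unfold_locales (fact assms)+
  assume "q = 3"
  thus "bij_betw (trace_map q :: 'a \<Rightarrow> 'a) (UNIV - {0}) (UNIV - {0})"
    using bij_CHAR_3 of_nat_q by simp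
qed

end
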